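(* Let $(V,E)$ be a finite, undirected, connected, non-bipartite, vertex-transitive graph which is regular of degree $d$ (multiple edges and loops are allowed), and let $h$ be its isoperimetric constant. Then every nontrivial eigenvalue $\lambda$ of the normalised adjacency operator of $(V,E)$ satisfies $$-1 + \frac{h^4}{2^9 d^{10}} < \lambda \leq 1 - \frac{h^2}{2d^2}.$$
   Context: The normalised adjacency operator of a $d$-regular graph is $\frac{1}{d}A$, where $A$ is its (symmetric) adjacency matrix; its trivial eigenvalue is $1$ (eigenvector the constant vector), and the nontrivial eigenvalues are the remaining ones. A graph is vertex-transitive if its automorphism group acts transitively on its vertex set. For $V'\subseteq V$, $\mathcal{N}(V')$ denotes the set of vertices adjacent to some vertex of $V'$. The isoperimetric constant $h$ is the largest $\varepsilon\ge 0$ such that $(V,E)$ is an $\varepsilon$-vertex expander, i.e. $h=\min\{|\mathcal{N}(A)\setminus A|/|A| : \emptyset\neq A\subseteq V,\ |A|\le |V|/2\}$. *)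

theory Defs
  imports "HOL-Analysis.Analysis" "HOL-Library.Uprod"
begin

text \<open>
  A finite undirected graph with vertex set \<open>UNIV :: 'v set\<close> is given by the multiset of its edges,
  an edge being an unordered pair of end points. Repetitions are multiple edges and
  \<open>Upair v v\<close> is a loop at \<open>v\<close>.
\<close>

type_synonym 'v multigraph = "'v uprod multiset"

definition adjacent :: "'v multigraph \<Rightarrow> 'v \<Rightarrow> 'v \<Rightarrow> bool" where
  "adjacent E u v \<longleftrightarrow> Upair u v \<in># E"

definition adjacency_matrix :: "'v::finite multigraph \<Rightarrow> real ^ 'v ^ 'v" where
  "adjacency_matrix E = (\<chi> u v. real (count E (Upair u v)))"

text \<open>
  A loop counts once, both in the degree and on the diagonal of the adjacency matrix, so that the
  row sums of the adjacency matrix are the degrees. The convention under which loops count twice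
  is the special case in which every loop has even multiplicity.
\<close>

definition degree :: "'v::finite multigraph \<Rightarrow> 'v \<Rightarrow> nat" where
  "degree E v = (\<Sum>w\<in>UNIV. count E (Upair v w))"

definition regular :: "'v::finite multigraph \<Rightarrow> nat \<Rightarrow> bool" where
  "regular E d \<longleftrightarrow> (\<forall>v. degree E v = d)"

definition graph_connected :: "'v multigraph \<Rightarrow> bool" where
  "graph_connected E \<longleftrightarrow> (\<forall>u v. (adjacent E)\<^sup>*\<^sup>* u v)"

definition bipartite :: "'v multigraph \<Rightarrow> bool" where
  "bipartite E \<longleftrightarrow>
     (\<exists>X Y. X \<union> Y = UNIV \<and> X \<inter> Y = {} \<and>
        (\<forall>u v. adjacent E u v \<longrightarrow> (u \<in> X \<and> v \<in> Y) \<or> (u \<in> Y \<and> v \<in> X)))"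

text \<open>The vertex permutations that preserve adjacency together with edge multiplicities.\<close>

definition automorphisms :: "'v multigraph \<Rightarrow> ('v \<Rightarrow> 'v) set" where
  "automorphisms E = {f. bij f \<and> image_mset (map_uprod f) E = E}"

definition vertex_transitive :: "'v multigraph \<Rightarrow> bool" where
  "vertex_transitive E \<longleftrightarrow> (\<forall>u v. \<exists>f\<in>automorphisms E. f u = v)"

definition neighbourhood :: "'v multigraph \<Rightarrow> 'v set \<Rightarrow> 'v set" where
  "neighbourhood E A = {v. \<exists>u\<in>A. adjacent E u v}"

text \<open>
  On a single vertex the set below is empty and the value is unspecified; such a graph has no
  nontrivial eigenvalues.
\<close>

definition isoperimetric_constant :: "'v::finite multigraph \<Rightarrow> real" where
  "isoperimetric_constant E =
     Min {real (card (neighbourhood E A - A)) / real (card A) | A.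
            A \<noteq> {} \<and> real (card A) \<le> real CARD('v) / 2}"

definition normalised_adjacency :: "'v::finite multigraph \<Rightarrow> nat \<Rightarrow> real ^ 'v ^ 'v" where
  "normalised_adjacency E d = (1 / real d) *\<^sub>R adjacency_matrix E"

definition eigenspace :: "real ^ 'n ^ 'n \<Rightarrow> real \<Rightarrow> (real ^ 'n::finite) set" where
  "eigenspace M l = {x. M *v x = l *\<^sub>R x}"

definition eigenvalue :: "real ^ 'n ^ 'n::finite \<Rightarrow> real \<Rightarrow> bool" where
  "eigenvalue M l \<longleftrightarrow> (\<exists>x\<in>eigenspace M l. x \<noteq> 0)"

text \<open>
  Eigenvalues are counted with multiplicity and one copy of the trivial eigenvalue \<open>1\<close> is discarded:
  \<open>1\<close> would itself be nontrivial if it were a multiple eigenvalue.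
\<close>

definition nontrivial_eigenvalue :: "real ^ 'n ^ 'n::finite \<Rightarrow> real \<Rightarrow> bool" where
  "nontrivial_eigenvalue M l \<longleftrightarrow> eigenvalue M l \<and> (l = 1 \<longrightarrow> 1 < dim (eigenspace M l))"

end

theory Submission
  imports Defs
begin

text \<open>
  The discrete Cheeger argument gives \<open>h\<^sup>2 \<Sum>(g u - m)\<^sup>2 \<le> d \<Sum>w u v (g u - g v)\<^sup>2\<close> for a median \<open>m\<close> of any
  function \<open>g\<close>. Applied to an eigenvector orthogonal to the constants it is the upper bound. For an
  eigenvalue near \<open>-1\<close> with eigenvector \<open>f\<close> it shows that \<open>\<bar>f\<bar>\<close> is nearly constant, so the sign of \<open>f\<close> is an
  almost bipartition. By expansion every automorphism almost preserves or almost exchanges its two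
  parts; averaging over those that almost preserve them yields an invariant partition, whose
  monochromatic edges, by transitivity, are either absent or too numerous. So the graph
  would be bipartite.
\<close>

section \<open>Finite counting and medians\<close>

lemma count_image_mset_inj: "inj f \<Longrightarrow> count (image_mset f M) (f x) = count M x"
  by (induction M) (auto simp: inj_eq)

lemma card_add_card_Compl: "card A + card (- A) = CARD('a)" for A :: "'a::finite set"
  by (metis card_Un_disjoint Compl_disjoint Compl_partition finite)

text \<open>The median is the least value of \<open>g\<close> that is exceeded on at most half of
  the points.\<close>

lemma ex_median:
  fixes g :: "'v::finite \<Rightarrow> real"
  obtains m where "2 * card {u. g u > m} \<le> CARD('v)"
    "2 * card {u. g u < m} \<le> CARD('v)"
proof -
  define S where "S = {t \<in> range g. 2 * card {u. g u > t} \<le> CARD('v)}"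
  have fin: "finite S" by (simp add: S_def)
  have "\<not> Max (range g) < g u" for u
    by (meson Max_ge finite_imageI finite rangeI not_less)
  then have "{u. g u > Max (range g)} = {}"
    by blast
  then have "Max (range g) \<in> S"
    by (simp add: S_def del: Max_less_iff)
  then have mS: "Min S \<in> S"
    using fin Min_in by blast
  have "2 * card {u. g u < Min S} \<le> CARD('v)"
  proof (cases "{u. g u < Min S} = {}")
    case False
    \<comment> \<open>\<open>t\<close> is the value of \<open>g\<close> just below
      \<open>Min S\<close>. By minimality more than half of the points lie above \<open>t\<close>,
      and every point below \<open>Min S\<close> is among the others.\<close>
    define t where "t = Max (g ` {u. g u < Min S})"
    have "t \<in> g ` {u. g u < Min S}"
      unfolding t_def using False by (intro Max_in) auto
    then have t: "t \<in> range g" "t < Min S" by auto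
    then have "t \<notin> S" using fin by (meson Min_le not_less)
    then have "2 * card {u. g u > t} > CARD('v)"
      using t by (simp add: S_def)
    moreover have "g u \<le> t" if "g u < Min S" for u
      unfolding t_def using that by (intro Max_ge) auto
    then have "{u. g u < Min S} \<subseteq> - {u. g u > t}" by force
    then have "card {u. g u < Min S} \<le> card (- {u. g u > t})"
      by (intro card_mono) auto
    ultimately show ?thesis using card_add_card_Compl[of "{u. g u > t}"] by linarith
  qed simp
  with mS show thesis
    by (intro that[of "Min S"]) (auto simp: S_def)
qed

section \<open>Weighted graphs, the Cheeger inequality and the upper bound\<close>

text \<open>Here \<open>h\<close> is only a lower bound for edge expansion. Vertex expansion implies
  it, since each outer boundary vertex of \<open>S\<close> receives at least one edge from
  \<open>S\<close>.\<close>

locale weighted_graph =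
  fixes w :: "'v::finite \<Rightarrow> 'v \<Rightarrow> real" and d h :: real
  assumes w_nonneg: "0 \<le> w u v"
    and w_sym: "w u v = w v u"
    and row_sum: "(\<Sum>v\<in>UNIV. w u v) = d"
    and d_pos: "0 < d"
    and h_nonneg: "0 \<le> h"
    and isoperimetric:
      "2 * card S \<le> CARD('v) \<Longrightarrow> h * card S \<le> (\<Sum>u\<in>S. \<Sum>v\<in>-S. w u v)"
begin

lemma weighted_sum_left: "(\<Sum>u\<in>UNIV. \<Sum>v\<in>UNIV. w u v * p u) = d * (\<Sum>u\<in>UNIV. p u)"
  by (simp add: row_sum flip: sum_distrib_left sum_distrib_right)

lemma weighted_sum_right: "(\<Sum>u\<in>UNIV. \<Sum>v\<in>UNIV. w u v * p v) = d * (\<Sum>u\<in>UNIV. p u)"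
  by (subst sum.swap, subst w_sym) (rule weighted_sum_left)

text \<open>The factor 2 arises because the sum over ordered pairs meets every cut edge in both
  directions.\<close>

lemma cut_ge:
  assumes "2 * card S \<le> CARD('v)"
  shows "2 * h * card S \<le> (\<Sum>u\<in>UNIV. \<Sum>v\<in>UNIV. w u v * of_bool ((u \<in> S) \<noteq> (v \<in> S)))"
proof -
  have "(\<Sum>v\<in>UNIV. w u v * of_bool ((u \<in> S) \<noteq> (v \<in> S))) =
      of_bool (u \<in> S) * (\<Sum>v\<in>-S. w u v) + of_bool (u \<in> -S) * (\<Sum>v\<in>S. w u v)" for u
  proof -
    have "(\<Sum>v\<in>UNIV. w u v * of_bool ((u \<in> S) \<noteq> (v \<in> S))) =
      (\<Sum>v\<in>S. w u v * of_bool ((u \<in> S) \<noteq> (v \<in> S))) + (\<Sum>v\<in>-S. w u v * of_bool ((u \<in> S) \<noteq> (v \<in> S)))"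
      by (subst sum.union_disjoint[symmetric]) (auto simp: Compl_partition)
    then show ?thesis by (cases "u \<in> S") auto
  qed
  then have "(\<Sum>u\<in>UNIV. \<Sum>v\<in>UNIV. w u v * of_bool ((u \<in> S) \<noteq> (v \<in> S))) =
      (\<Sum>u\<in>S. \<Sum>v\<in>-S. w u v) + (\<Sum>u\<in>-S. \<Sum>v\<in>S. w u v)"
    by (simp add: sum.distrib of_bool_def if_distrib[of "\<lambda>x. x * _"] Compl_eq
        flip: sum.inter_filter cong: if_cong)
  also have "(\<Sum>u\<in>-S. \<Sum>v\<in>S. w u v) = (\<Sum>u\<in>S. \<Sum>v\<in>-S. w u v)"
    by (subst sum.swap, subst w_sym) simp
  finally show ?thesis using isoperimetric[OF assms] by linarith
qed

text \<open>The coarea inequality, by peeling off one level set of \<open>q\<close> at a time.\<close>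

lemma coarea:
  assumes "\<And>u. 0 \<le> q u" "2 * card {u. q u \<noteq> 0} \<le> CARD('v)"
  shows "2 * h * (\<Sum>u\<in>UNIV. q u) \<le> (\<Sum>u\<in>UNIV. \<Sum>v\<in>UNIV. w u v * \<bar>q u - q v\<bar>)"
  using assms
proof (induction "card {u. q u \<noteq> 0}" arbitrary: q rule: less_induct)
  case less
  define S where "S = {u. q u \<noteq> 0}"
  show ?case
  proof (cases "S = {}")
    case True
    then have "q u = 0" for u by (auto simp: S_def)
    then show ?thesis by simp
  next
    case False
    define m where "m = Min (q ` S)"
    define q' where "q' u = q u - m * of_bool (u \<in> S)" for u
    have "m \<in> q ` S" using False by (auto simp: m_def)
    then obtain x where x: "x \<in> S" "q x = m" by auto
    have m_pos: "m > 0" using less.prems(1)[of x] x by (auto simp: S_def)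
    have m_le: "m \<le> q u" if "u \<in> S" for u
      unfolding m_def using that by (intro Min_le) auto
    have q'_nonneg: "0 \<le> q' u" for u
      using m_le less.prems(1) by (simp add: q'_def)
    have "{u. q' u \<noteq> 0} \<subseteq> S - {x}"
      using x by (auto simp: q'_def S_def)
    then have "{u. q' u \<noteq> 0} \<subset> S" using x by blast
    then have lt: "card {u. q' u \<noteq> 0} < card S" by (intro psubset_card_mono) auto
    have IH: "2 * h * (\<Sum>u\<in>UNIV. q' u) \<le> (\<Sum>u\<in>UNIV. \<Sum>v\<in>UNIV. w u v * \<bar>q' u - q' v\<bar>)"
      using less.hyps[of q'] lt q'_nonneg less.prems(2) by (simp add: S_def)
    \<comment> \<open>Lowering \<open>q\<close> by its least value \<open>m\<close> on the support
      keeps the order of any two values, so a difference loses \<open>m\<close> if \<open>S\<close>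
      separates the pair and nothing otherwise.\<close>
    have diff: "\<bar>q u - q v\<bar> = \<bar>q' u - q' v\<bar> + m * of_bool ((u \<in> S) \<noteq> (v \<in> S))" for u v
      using m_le[of u] m_le[of v] m_pos by (auto simp: q'_def S_def)
    have "(\<Sum>u\<in>UNIV. \<Sum>v\<in>UNIV. w u v * \<bar>q u - q v\<bar>) =
       (\<Sum>u\<in>UNIV. \<Sum>v\<in>UNIV. w u v * \<bar>q' u - q' v\<bar>) +
       m * (\<Sum>u\<in>UNIV. \<Sum>v\<in>UNIV. w u v * of_bool ((u \<in> S) \<noteq> (v \<in> S)))"
      unfolding diff by (simp only: distrib_left sum.distrib sum_distrib_left mult.left_commute)
    moreover have "m * (2 * h * card S) \<le>
        m * (\<Sum>u\<in>UNIV. \<Sum>v\<in>UNIV. w u v * of_bool ((u \<in> S) \<noteq> (v \<in> S)))"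
      using m_pos less.prems(2) by (intro mult_left_mono cut_ge) (auto simp: S_def)
    moreover have "(\<Sum>u\<in>UNIV. q' u) = (\<Sum>u\<in>UNIV. q u) - m * card S"
      by (simp add: q'_def sum_subtractf sum_distrib_left[symmetric])
    then have "2 * h * (\<Sum>u\<in>UNIV. q' u) = 2 * h * (\<Sum>u\<in>UNIV. q u) - m * (2 * h * card S)"
      by (simp only: right_diff_distrib mult_ac)
    ultimately show ?thesis using IH by linarith
  qed
qed

text \<open>The coarea inequality is applied to the square of \<open>g\<close>, whose differences
  factor. A weighted AM-GM inequality replaces Cauchy-Schwarz; its weights are such that the terms
  in \<open>h\<^sup>2\<close> absorb exactly half of the left-hand side.\<close>

lemma cheeger_nonneg:
  assumes nonneg: "\<And>u. 0 \<le> g u" and supp: "2 * card {u. g u \<noteq> 0} \<le> CARD('v)"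
  shows "h\<^sup>2 * (\<Sum>u\<in>UNIV. (g u)\<^sup>2) \<le> d * (\<Sum>u\<in>UNIV. \<Sum>v\<in>UNIV. w u v * (g u - g v)\<^sup>2)"
proof -
  let ?G = "\<Sum>u\<in>UNIV. (g u)\<^sup>2" and ?D = "\<Sum>u\<in>UNIV. \<Sum>v\<in>UNIV. w u v * (g u - g v)\<^sup>2"
  let ?C = "\<Sum>u\<in>UNIV. \<Sum>v\<in>UNIV. w u v * \<bar>(g u)\<^sup>2 - (g v)\<^sup>2\<bar>"
  have pt: "4 * d * h * (w u v * \<bar>(g u)\<^sup>2 - (g v)\<^sup>2\<bar>) \<le>
      4 * d\<^sup>2 * (w u v * (g u - g v)\<^sup>2) + 2 * h\<^sup>2 * (w u v * (g u)\<^sup>2) + 2 * h\<^sup>2 * (w u v * (g v)\<^sup>2)" for u v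
  proof -
    have "\<bar>(g u)\<^sup>2 - (g v)\<^sup>2\<bar> = \<bar>g u - g v\<bar> * (g u + g v)"
      using nonneg[of u] nonneg[of v] by (simp add: square_diff_square_factored power2_eq_square abs_mult)
    moreover have "0 \<le> (2 * d * \<bar>g u - g v\<bar> - h * (g u + g v))\<^sup>2" by simp
    then have "4 * d * h * (\<bar>g u - g v\<bar> * (g u + g v)) \<le> 4 * d\<^sup>2 * (\<bar>g u - g v\<bar>)\<^sup>2 + h\<^sup>2 * (g u + g v)\<^sup>2"
      unfolding power2_diff power_mult_distrib by (simp add: algebra_simps)
    moreover have "0 \<le> h\<^sup>2 * (g u - g v)\<^sup>2" by simp
    then have "h\<^sup>2 * (g u + g v)\<^sup>2 \<le> 2 * h\<^sup>2 * (g u)\<^sup>2 + 2 * h\<^sup>2 * (g v)\<^sup>2"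
      by (simp add: power2_eq_square algebra_simps)
    ultimately have "4 * d * h * \<bar>(g u)\<^sup>2 - (g v)\<^sup>2\<bar> \<le>
        4 * d\<^sup>2 * (g u - g v)\<^sup>2 + 2 * h\<^sup>2 * (g u)\<^sup>2 + 2 * h\<^sup>2 * (g v)\<^sup>2"
      by simp
    from mult_left_mono[OF this w_nonneg[of u v]] show ?thesis by (simp add: algebra_simps)
  qed
  have "2 * h * ?G \<le> ?C"
    using supp by (intro coarea) auto
  then have "4 * d * h * (2 * h * ?G) \<le> 4 * d * h * ?C"
    using d_pos h_nonneg by (intro mult_left_mono) auto
  also have "\<dots> \<le> (\<Sum>u\<in>UNIV. \<Sum>v\<in>UNIV. 4 * d\<^sup>2 * (w u v * (g u - g v)\<^sup>2) +
      2 * h\<^sup>2 * (w u v * (g u)\<^sup>2) + 2 * h\<^sup>2 * (w u v * (g v)\<^sup>2))"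
    unfolding sum_distrib_left by (intro sum_mono pt)
  also have "\<dots> = 4 * d\<^sup>2 * ?D + 2 * h\<^sup>2 * (d * ?G) + 2 * h\<^sup>2 * (d * ?G)"
    by (simp add: sum.distrib weighted_sum_left weighted_sum_right flip: sum_distrib_left)
  finally have "(4 * d) * (h\<^sup>2 * ?G) \<le> (4 * d) * (d * ?D)"
    by (simp add: power2_eq_square algebra_simps)
  then show ?thesis using d_pos by simp
qed

text \<open>The positive and negative parts of \<open>g - m\<close> each live on at most half of the
  vertices. One increases with \<open>g\<close> and the other decreases, so the cross term has the
  right sign and their energies add up to at most that of \<open>g\<close>.\<close>

lemma poincare_median:
  obtains m where "h\<^sup>2 * (\<Sum>u\<in>UNIV. (g u - m)\<^sup>2) \<le> d * (\<Sum>u\<in>UNIV. \<Sum>v\<in>UNIV. w u v * (g u - g v)\<^sup>2)"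
proof -
  obtain m where m: "2 * card {u. g u > m} \<le> CARD('v)"
    "2 * card {u. g u < m} \<le> CARD('v)"
    by (rule ex_median)
  define p n where "p u = max (g u - m) 0" and "n u = max (m - g u) 0" for u
  have "{u. p u \<noteq> 0} = {u. g u > m}" "{u. n u \<noteq> 0} = {u. g u < m}"
    by (auto simp: p_def n_def max_def)
  then have le: "h\<^sup>2 * (\<Sum>u\<in>UNIV. (p u)\<^sup>2) \<le> d * (\<Sum>u\<in>UNIV. \<Sum>v\<in>UNIV. w u v * (p u - p v)\<^sup>2)"
      "h\<^sup>2 * (\<Sum>u\<in>UNIV. (n u)\<^sup>2) \<le> d * (\<Sum>u\<in>UNIV. \<Sum>v\<in>UNIV. w u v * (n u - n v)\<^sup>2)"
    using m by (intro cheeger_nonneg; simp add: p_def n_def)+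
  have sq: "(g u - m)\<^sup>2 = (p u)\<^sup>2 + (n u)\<^sup>2" for u
    by (auto simp: p_def n_def max_def power2_eq_square algebra_simps)
  have "(p u - p v)\<^sup>2 + (n u - n v)\<^sup>2 \<le> (g u - g v)\<^sup>2" for u v
  proof -
    have "g u - g v = (p u - p v) - (n u - n v)" by (auto simp: p_def n_def max_def)
    moreover have "(p u - p v) * (n u - n v) \<le> 0"
      by (auto simp: p_def n_def max_def mult_le_0_iff)
    ultimately show ?thesis by (simp only: power2_diff[of "p u - p v"])
  qed
  then have "(\<Sum>u\<in>UNIV. \<Sum>v\<in>UNIV. w u v * ((p u - p v)\<^sup>2 + (n u - n v)\<^sup>2)) \<le>
      (\<Sum>u\<in>UNIV. \<Sum>v\<in>UNIV. w u v * (g u - g v)\<^sup>2)"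
    by (intro sum_mono mult_left_mono w_nonneg)
  from mult_left_mono[OF this, of d] le
  have "h\<^sup>2 * (\<Sum>u\<in>UNIV. (g u - m)\<^sup>2) \<le> d * (\<Sum>u\<in>UNIV. \<Sum>v\<in>UNIV. w u v * (g u - g v)\<^sup>2)"
    using d_pos by (simp add: sq sum.distrib distrib_left)
  then show thesis by (rule that)
qed

text \<open>The sign \<open>s = -1\<close> gives the usual Dirichlet form, for eigenvalues near 1;
  \<open>s = 1\<close> gives the signless one, for eigenvalues near -1.\<close>

lemma dirichlet_form_eigenfunction:
  assumes eig: "\<And>u. (\<Sum>v\<in>UNIV. w u v * f v) = l * d * f u" and s: "s\<^sup>2 = 1"
  shows "(\<Sum>u\<in>UNIV. \<Sum>v\<in>UNIV. w u v * (f u + s * f v)\<^sup>2) = 2 * d * (1 + s * l) * (\<Sum>u\<in>UNIV. (f u)\<^sup>2)"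
proof -
  have "w u v * (f u + s * f v)\<^sup>2 = w u v * (f u)\<^sup>2 + w u v * (f v)\<^sup>2 + 2 * s * (f u * (w u v * f v))" for u v
    by (simp add: power2_sum power_mult_distrib s algebra_simps)
  then have "(\<Sum>u\<in>UNIV. \<Sum>v\<in>UNIV. w u v * (f u + s * f v)\<^sup>2) =
      d * (\<Sum>u\<in>UNIV. (f u)\<^sup>2) + d * (\<Sum>u\<in>UNIV. (f u)\<^sup>2) + 2 * s * (\<Sum>u\<in>UNIV. f u * (l * d * f u))"
    by (simp add: sum.distrib weighted_sum_left weighted_sum_right eig flip: sum_distrib_left)
  also have "(\<Sum>u\<in>UNIV. f u * (l * d * f u)) = l * d * (\<Sum>u\<in>UNIV. (f u)\<^sup>2)"
    by (simp add: sum_distrib_left power2_eq_square algebra_simps)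
  finally show ?thesis by (simp add: algebra_simps)
qed

text \<open>Orthogonality to the constants means that subtracting the median can only increase the
  sum of squares, so the Poincare inequality bounds the norm of \<open>f\<close> itself.\<close>

lemma eigenvalue_upper_bound:
  assumes eig: "\<And>u. (\<Sum>v\<in>UNIV. w u v * f v) = l * d * f u"
    and nz: "f x \<noteq> 0" and orth: "(\<Sum>u\<in>UNIV. f u) = 0"
  shows "l \<le> 1 - h\<^sup>2 / (2 * d\<^sup>2)"
proof -
  let ?N = "\<Sum>u\<in>UNIV. (f u)\<^sup>2"
  obtain m where m: "h\<^sup>2 * (\<Sum>u\<in>UNIV. (f u - m)\<^sup>2) \<le> d * (\<Sum>u\<in>UNIV. \<Sum>v\<in>UNIV. w u v * (f u - f v)\<^sup>2)"
    by (rule poincare_median)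
  have N: "?N > 0"
    using nz by (intro sum_pos2[of _ x]) auto
  have "(\<Sum>u\<in>UNIV. (f u - m)\<^sup>2) = ?N + CARD('v) * m\<^sup>2"
    using orth by (simp add: power2_diff sum.distrib sum_subtractf flip: sum_distrib_right sum_distrib_left)
  then have "?N \<le> (\<Sum>u\<in>UNIV. (f u - m)\<^sup>2)" by simp
  then have "h\<^sup>2 * ?N \<le> h\<^sup>2 * (\<Sum>u\<in>UNIV. (f u - m)\<^sup>2)" by (intro mult_left_mono) auto
  also note m
  also have "(\<Sum>u\<in>UNIV. \<Sum>v\<in>UNIV. w u v * (f u - f v)\<^sup>2) = 2 * d * (1 - l) * ?N"
    using dirichlet_form_eigenfunction[OF eig, of "-1"] by simp
  finally have "h\<^sup>2 * ?N \<le> (2 * d\<^sup>2 * (1 - l)) * ?N" by (simp add: power2_eq_square algebra_simps)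
  then have "h\<^sup>2 \<le> 2 * d\<^sup>2 * (1 - l)" using N by simp
  then show ?thesis using d_pos by (simp add: field_simps)
qed

section \<open>An almost bipartition from an eigenvalue near -1\<close>

text \<open>This vanishes exactly when \<open>X\<close> and its complement form a bipartition.
  Ordered pairs are summed, so loops count once and other edges twice.\<close>

definition monochromatic_weight :: "'v set \<Rightarrow> real" where
  "monochromatic_weight X = (\<Sum>u\<in>UNIV. \<Sum>v\<in>UNIV. w u v * of_bool ((u \<in> X) = (v \<in> X)))"

text \<open>
  If \<open>l\<close> is close to \<open>-1\<close>, then \<open>\<bar>f\<bar>\<close> has small Dirichlet form, so by the Poincare inequality it is
  close to a constant, and on each side of the sign partition few edges can survive.
\<close>

lemma monochromatic_weight_sign_le:
  assumes eig: "\<And>u. (\<Sum>v\<in>UNIV. w u v * f v) = l * d * f u" and nz: "f x \<noteq> 0"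
    and h: "0 < h" "h \<le> d" "1 \<le> d" and l: "1 + l \<le> h ^ 4 / (2 ^ 9 * d ^ 10)"
  shows "monochromatic_weight {u. f u > 0} \<le> h * (h * CARD('v) / (16 * d ^ 7))"
proof -
  let ?N = "\<Sum>u\<in>UNIV. (f u)\<^sup>2" and ?n = "real CARD('v)"
  let ?b = "monochromatic_weight {u. f u > 0}"
  \<comment> \<open>Chosen so that
    \<open>2 * d\<^sup>2 * (h ^ 4 / (2 ^ 9 * d ^ 10)) = h\<^sup>2 * e\<close>; it bounds the
    relative squared distance of \<open>\<bar>f\<bar>\<close> from the constant
    \<open>m\<close>.\<close>
  define e where "e = h\<^sup>2 / (2 ^ 8 * d ^ 8)"
  obtain m where m: "h\<^sup>2 * (\<Sum>u\<in>UNIV. (\<bar>f u\<bar> - m)\<^sup>2) \<le>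
      d * (\<Sum>u\<in>UNIV. \<Sum>v\<in>UNIV. w u v * (\<bar>f u\<bar> - \<bar>f v\<bar>)\<^sup>2)"
    by (rule poincare_median)
  let ?K = "\<Sum>u\<in>UNIV. (\<bar>f u\<bar> - m)\<^sup>2"
  have N: "?N > 0"
    using nz by (intro sum_pos2[of _ x]) auto
  have plus: "(\<Sum>u\<in>UNIV. \<Sum>v\<in>UNIV. w u v * (f u + f v)\<^sup>2) = 2 * d * (1 + l) * ?N"
    using dirichlet_form_eigenfunction[OF eig, of 1] by simp
  have "(\<bar>a\<bar> - \<bar>b\<bar>)\<^sup>2 \<le> (a + b)\<^sup>2" for a b :: real
    by (metis abs_le_square_iff abs_minus_cancel abs_triangle_ineq3 diff_minus_eq_add)
  then have "(\<Sum>u\<in>UNIV. \<Sum>v\<in>UNIV. w u v * (\<bar>f u\<bar> - \<bar>f v\<bar>)\<^sup>2) \<le> 2 * d * (1 + l) * ?N"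
    unfolding plus[symmetric] by (intro sum_mono mult_left_mono w_nonneg)
  then have "d * (\<Sum>u\<in>UNIV. \<Sum>v\<in>UNIV. w u v * (\<bar>f u\<bar> - \<bar>f v\<bar>)\<^sup>2) \<le> d * (2 * d * (1 + l) * ?N)"
    using d_pos by (intro mult_left_mono) auto
  also have "\<dots> = 2 * d\<^sup>2 * ?N * (1 + l)" by (simp add: power2_eq_square)
  also have "\<dots> \<le> 2 * d\<^sup>2 * ?N * (h ^ 4 / (2 ^ 9 * d ^ 10))"
    using l N by (intro mult_left_mono) auto
  also have "\<dots> = h\<^sup>2 * (e * ?N)"
    using d_pos by (simp add: e_def field_simps flip: power_add)
  finally have "h\<^sup>2 * ?K \<le> h\<^sup>2 * (e * ?N)" using m by linarith
  then have K: "?K \<le> e * ?N" using h by simp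
  have "h\<^sup>2 \<le> d\<^sup>2" using h by (intro power_mono) auto
  also have "d\<^sup>2 \<le> d ^ 8" using h by (intro power_increasing) auto
  finally have e: "0 \<le> e" "e \<le> 1 / 256" using d_pos by (auto simp: e_def field_simps)
  have "h ^ 4 / (2 ^ 9 * d ^ 10) = (h\<^sup>2 / d\<^sup>2) * e / 2"
    using d_pos by (simp add: e_def field_simps flip: power_add)
  also have "\<dots> \<le> 1 * e / 2"
    using \<open>h\<^sup>2 \<le> d\<^sup>2\<close> d_pos e by (intro divide_right_mono mult_right_mono) auto
  finally have l': "1 + l \<le> e / 2" using l by simp
  \<comment> \<open>Since \<open>\<bar>f\<bar>\<close> is close to \<open>m\<close>, the constant
    \<open>m\<close> cannot be small: its square is at least a quarter of the mean of
    \<open>f\<^sup>2\<close>.\<close>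
  have "(f u)\<^sup>2 \<le> 2 * (\<bar>f u\<bar> - m)\<^sup>2 + 2 * m\<^sup>2" for u
  proof -
    have "0 \<le> (\<bar>f u\<bar> - 2 * m)\<^sup>2" by simp
    then show ?thesis by (simp add: power2_diff power_mult_distrib)
  qed
  then have "?N \<le> (\<Sum>u\<in>UNIV. 2 * (\<bar>f u\<bar> - m)\<^sup>2 + 2 * m\<^sup>2)" by (intro sum_mono)
  also have "\<dots> = 2 * ?K + 2 * ?n * m\<^sup>2" by (simp add: sum.distrib flip: sum_distrib_left)
  finally have "?N \<le> 2 * (e * ?N) + 2 * ?n * m\<^sup>2" using K by linarith
  moreover have "e * ?N \<le> 1 / 256 * ?N" using e N by (intro mult_right_mono) auto
  ultimately have M: "?N / 4 \<le> ?n * m\<^sup>2" using N by linarith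
  have pt: "m\<^sup>2 * (w u v * of_bool ((u \<in> {u. f u > 0}) = (v \<in> {u. f u > 0}))) \<le>
      w u v * (f u + f v)\<^sup>2 + w u v * (\<bar>f u\<bar> - m)\<^sup>2 + w u v * (\<bar>f v\<bar> - m)\<^sup>2" for u v
  proof (cases "(f u > 0) = (f v > 0)")
    case True
    then have "f u * f v \<ge> 0" by (auto simp: zero_le_mult_iff)
    \<comment> \<open>Half the sum of these two squares plus \<open>2 * (f u * f v)\<close> is the
      right-hand side minus the left-hand side of the next inequality.\<close>
    moreover have "0 \<le> (2 * \<bar>f u\<bar> - m)\<^sup>2" "0 \<le> (2 * \<bar>f v\<bar> - m)\<^sup>2" by simp_all
    ultimately have "m\<^sup>2 \<le> (f u + f v)\<^sup>2 + (\<bar>f u\<bar> - m)\<^sup>2 + (\<bar>f v\<bar> - m)\<^sup>2"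
      by (simp add: power2_diff power2_sum power_mult_distrib)
    from mult_left_mono[OF this w_nonneg[of u v]] True show ?thesis by (simp add: algebra_simps)
  qed (simp add: w_nonneg)
  have "m\<^sup>2 * ?b \<le> (\<Sum>u\<in>UNIV. \<Sum>v\<in>UNIV.
      w u v * (f u + f v)\<^sup>2 + w u v * (\<bar>f u\<bar> - m)\<^sup>2 + w u v * (\<bar>f v\<bar> - m)\<^sup>2)"
    unfolding monochromatic_weight_def sum_distrib_left by (intro sum_mono pt)
  also have "\<dots> = 2 * d * (1 + l) * ?N + 2 * d * ?K"
    by (simp add: sum.distrib plus weighted_sum_left[of "\<lambda>u. (\<bar>f u\<bar> - m)\<^sup>2"]
        weighted_sum_right[of "\<lambda>u. (\<bar>f u\<bar> - m)\<^sup>2"])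
  also have "\<dots> = 2 * d * ((1 + l) * ?N + ?K)" by (simp add: algebra_simps)
  also have "\<dots> \<le> 2 * d * (e / 2 * ?N + e * ?N)"
    using l' K N d_pos by (intro mult_left_mono add_mono mult_right_mono) auto
  finally have b: "m\<^sup>2 * ?b \<le> 3 * d * e * ?N" by (simp add: algebra_simps)
  have b0: "0 \<le> ?b" unfolding monochromatic_weight_def by (intro sum_nonneg) (simp add: w_nonneg)
  have "?N * (?b / 4) = ?N / 4 * ?b" by simp
  also have "\<dots> \<le> ?n * m\<^sup>2 * ?b" using M b0 by (intro mult_right_mono) auto
  also have "\<dots> = ?n * (m\<^sup>2 * ?b)" by simp
  also have "\<dots> \<le> ?n * (3 * d * e * ?N)" using b by (intro mult_left_mono) auto
  also have "\<dots> = ?N * (3 * d * e * ?n)" by simp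
  finally have "?b / 4 \<le> 3 * d * e * ?n" using N by simp
  also have "3 * d * e * ?n = (3 / 16) * (h\<^sup>2 * ?n / (16 * d ^ 7))"
    using d_pos by (simp add: e_def field_simps eval_nat_numeral)
  also have "\<dots> \<le> (1 / 4) * (h\<^sup>2 * ?n / (16 * d ^ 7))"
    using d_pos by (intro mult_right_mono) auto
  finally show ?thesis by (simp add: power2_eq_square algebra_simps)
qed

section \<open>Automorphisms and the exact bipartition\<close>

definition weight_automorphisms :: "('v \<Rightarrow> 'v) set" where
  "weight_automorphisms = {g. bij g \<and> (\<forall>u v. w (g u) (g v) = w u v)}"

lemma weight_automorphisms_comp:
  "g \<in> weight_automorphisms \<Longrightarrow> k \<in> weight_automorphisms \<Longrightarrow> g \<circ> k \<in> weight_automorphisms"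
  by (auto simp: weight_automorphisms_def intro: bij_comp)

lemma card_vimage_bij: "bij g \<Longrightarrow> card {u. g u \<in> X} = card X" for g :: "'v \<Rightarrow> 'v"
  using card_vimage_inj[of g X] by (simp add: bij_def vimage_def)

text \<open>
  An edge crossing the boundary of the set of vertices whose colour is changed by \<open>g\<close> is
  monochromatic for exactly one of the partitions \<open>L\<close> and \<open>g\<^sup>-\<^sup>1 L\<close>.
\<close>

lemma colour_change_small_or_cosmall:
  fixes t :: real
  assumes g: "g \<in> weight_automorphisms" and L: "monochromatic_weight L \<le> h * t" and "0 < h"
  defines "T \<equiv> {u. (u \<in> L) \<noteq> (g u \<in> L)}"
  shows "card T \<le> t \<or> card (- T) \<le> t"
proof -
  have bij: "bij g" using g by (simp add: weight_automorphisms_def)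
  have "(\<Sum>u\<in>UNIV. \<Sum>v\<in>UNIV. w u v * of_bool ((g u \<in> L) = (g v \<in> L))) =
     (\<Sum>u\<in>UNIV. \<Sum>v\<in>UNIV. w (g u) (g v) * of_bool ((g u \<in> L) = (g v \<in> L)))"
    using g by (simp add: weight_automorphisms_def)
  also have "\<dots> = monochromatic_weight L"
    unfolding monochromatic_weight_def
    by (subst sum.reindex_bij_betw[OF bij, of "\<lambda>v. w _ v * of_bool (_ = (v \<in> L))"])
       (rule sum.reindex_bij_betw[OF bij])
  finally have gL: "(\<Sum>u\<in>UNIV. \<Sum>v\<in>UNIV. w u v * of_bool ((g u \<in> L) = (g v \<in> L))) = monochromatic_weight L" .
  have "(\<Sum>u\<in>UNIV. \<Sum>v\<in>UNIV. w u v * of_bool ((u \<in> T) \<noteq> (v \<in> T))) \<le>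
     (\<Sum>u\<in>UNIV. \<Sum>v\<in>UNIV. w u v * of_bool ((u \<in> L) = (v \<in> L)) + w u v * of_bool ((g u \<in> L) = (g v \<in> L)))"
    by (intro sum_mono) (auto simp: T_def w_nonneg)
  also have "\<dots> = 2 * monochromatic_weight L"
    by (simp only: sum.distrib gL) (simp add: monochromatic_weight_def)
  finally have cut: "(\<Sum>u\<in>UNIV. \<Sum>v\<in>UNIV. w u v * of_bool ((u \<in> T) \<noteq> (v \<in> T))) \<le> 2 * (h * t)"
    using L by simp
  \<comment> \<open>\<open>T\<close> and its complement have the same cut, and expansion applies to
    whichever has at most half of the vertices.\<close>
  consider "2 * card T \<le> CARD('v)" | "2 * card (- T) \<le> CARD('v)"
    using card_add_card_Compl[of T] by linarith
  then show ?thesis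
  proof cases
    case 1
    from cut_ge[OF this] cut have "2 * h * card T \<le> 2 * h * t" by simp
    then show ?thesis using \<open>0 < h\<close> by simp
  next
    case 2
    have "(\<Sum>u\<in>UNIV. \<Sum>v\<in>UNIV. w u v * of_bool ((u \<in> - T) \<noteq> (v \<in> - T))) =
      (\<Sum>u\<in>UNIV. \<Sum>v\<in>UNIV. w u v * of_bool ((u \<in> T) \<noteq> (v \<in> T)))"
      by (intro sum.cong) auto
    with cut_ge[OF 2] cut have "2 * h * card (- T) \<le> 2 * h * t" by simp
    then show ?thesis using \<open>0 < h\<close> by simp
  qed
qed

text \<open>
  The automorphisms that almost preserve \<open>L\<close> form a subgroup \<open>H\<close> of index at most two. The majority
  vote \<open>X\<close> over the \<open>H\<close>-translates of \<open>L\<close> is \<open>H\<close>-invariant and close to \<open>L\<close>; the set \<open>Q\<close> of vertices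
  with a monochromatic edge for \<open>X\<close> is \<open>H\<close>-invariant too, hence empty or at least half of
  all vertices, and it is too small for the latter.
\<close>

lemma bipartition_of_almost_bipartition:
  assumes integral: "\<And>u v. w u v \<noteq> 0 \<Longrightarrow> 1 \<le> w u v"
    and trans: "\<And>u v. \<exists>g\<in>weight_automorphisms. g u = v"
    and L: "monochromatic_weight L \<le> h * t" and h: "0 < h"
    and t: "3 * t < CARD('v)" "2 * (h + 4 * d) * t < CARD('v)"
  obtains X where "\<And>u v. w u v \<noteq> 0 \<Longrightarrow> (u \<in> X) \<noteq> (v \<in> X)"
proof -
  define T where "T g = {u. (u \<in> L) \<noteq> (g u \<in> L)}" for g
  define H where "H = {g \<in> weight_automorphisms. card (T g) \<le> t}"
  have fin: "finite H" by simp
  have dich: "card (- T g) \<le> t" if "g \<in> weight_automorphisms" "g \<notin> H" for g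
    using colour_change_small_or_cosmall[OF that(1) L h] that by (auto simp: H_def T_def)
  \<comment> \<open>A gap: outside \<open>H\<close> the complement has at most \<open>t\<close>
    elements, and \<open>3 * t\<close> is less than the number of vertices. Hence a bound of
    \<open>2 * t\<close> improves to \<open>t\<close>.\<close>
  have H_I: "g \<in> H" if g: "g \<in> weight_automorphisms" and c: "card (T g) \<le> 2 * t" for g
  proof (rule ccontr)
    assume "g \<notin> H"
    with dich[OF g] c t(1) card_add_card_Compl[of "T g"] show False by linarith
  qed
  have "0 \<le> h * t" using L
    by (rule order_trans[rotated]) (auto simp: monochromatic_weight_def w_nonneg intro!: sum_nonneg)
  then have t0: "0 \<le> t" using h by (simp add: zero_le_mult_iff)
  have id: "id \<in> H" using t0 by (simp add: H_def T_def weight_automorphisms_def)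
  \<comment> \<open>\<open>T (g \<circ> k)\<close> is the symmetric difference of \<open>T k\<close>
    and the preimage of \<open>T g\<close> under \<open>k\<close>. It is unchanged when both are
    replaced by their complements, so this serves two factors in \<open>H\<close> as well as two
    outside.\<close>
  have comp_le: "g \<circ> k \<in> H" if gk: "g \<in> weight_automorphisms" "k \<in> weight_automorphisms"
      and sub: "T (g \<circ> k) \<subseteq> A \<union> {u. k u \<in> B}" and le: "card A \<le> t" "card B \<le> t" for g k A B
  proof (intro H_I weight_automorphisms_comp gk)
    have "card (T (g \<circ> k)) \<le> card (A \<union> {u. k u \<in> B})" using sub by (intro card_mono) auto
    also have "\<dots> \<le> card A + card {u. k u \<in> B}" by (rule card_Un_le)
    also have "card {u. k u \<in> B} = card B"
      using gk by (intro card_vimage_bij) (simp add: weight_automorphisms_def)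
    finally show "card (T (g \<circ> k)) \<le> 2 * t" using le by linarith
  qed
  have comp: "g \<circ> k \<in> H" if "g \<in> H" "k \<in> H" for g k
    by (rule comp_le[of g k "T k" "T g"]) (use that in \<open>auto simp: H_def T_def\<close>)
  \<comment> \<open>This is the statement that \<open>H\<close> has index at most two.\<close>
  have comp': "g \<circ> k \<in> H"
    if "g \<in> weight_automorphisms" "g \<notin> H" "k \<in> weight_automorphisms" "k \<notin> H" for g k
    by (rule comp_le[of g k "- T k" "- T g"]) (use that dich in \<open>auto simp: T_def\<close>)
  define X where "X = {u. card H < 2 * card {k \<in> H. k u \<in> L}}"
  have X_inv: "g u \<in> X \<longleftrightarrow> u \<in> X" if g: "g \<in> H" for g u
  proof -
    have "surj g" using g by (auto simp: H_def weight_automorphisms_def bij_def)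
    \<comment> \<open>Right composition with \<open>g\<close> is an injection of the finite set
      \<open>H\<close> into itself, hence permutes the voters.\<close>
    have inj: "inj_on (\<lambda>k. k \<circ> g) H"
      by (rule inj_onI) (metis \<open>surj g\<close> surj_fun_eq comp_apply)
    have H: "(\<lambda>k. k \<circ> g) ` H = H"
      using comp g by (intro card_subset_eq fin card_image inj) auto
    have "{k \<in> (\<lambda>k. k \<circ> g) ` H. k u \<in> L} = (\<lambda>k. k \<circ> g) ` {k \<in> H. k (g u) \<in> L}"
      by auto
    then have eq: "{k \<in> H. k u \<in> L} = (\<lambda>k. k \<circ> g) ` {k \<in> H. k (g u) \<in> L}"
      unfolding H .
    have "card {k \<in> H. k u \<in> L} = card {k \<in> H. k (g u) \<in> L}"
      unfolding eq by (intro card_image inj_on_subset[OF inj]) auto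
    then show ?thesis by (simp add: X_def)
  qed
  define Y where "Y = {u. (u \<in> X) \<noteq> (u \<in> L)}"
  \<comment> \<open>Where the majority disagrees with \<open>L\<close>, at least half of
    \<open>H\<close> changes the colour. Ties are placed outside \<open>X\<close>, so the inequality
    is not strict.\<close>
  have vote: "card H \<le> 2 * card {k \<in> H. u \<in> T k}" if "u \<in> Y" for u
  proof (cases "u \<in> L")
    case True
    have "card {k \<in> H. k u \<in> L} + card {k \<in> H. u \<in> T k} = card ({k \<in> H. k u \<in> L} \<union> {k \<in> H. u \<in> T k})"
      using True by (intro card_Un_disjoint[symmetric]) (auto simp: T_def)
    also have "{k \<in> H. k u \<in> L} \<union> {k \<in> H. u \<in> T k} = H" using True by (auto simp: T_def)
    finally show ?thesis using that True by (auto simp: Y_def X_def)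
  next
    case False
    then have "{k \<in> H. u \<in> T k} = {k \<in> H. k u \<in> L}" by (auto simp: T_def)
    then show ?thesis using that False by (auto simp: Y_def X_def)
  qed
  have "real (card H) \<le> 2 * real (card {k \<in> H. u \<in> T k})" if "u \<in> Y" for u
    using vote[OF that] by linarith
  \<comment> \<open>Double counting of the pairs \<open>(u, k)\<close> with
    \<open>u \<in> T k\<close>: at least half of \<open>H\<close> for each \<open>u \<in> Y\<close>,
    at most \<open>t\<close> vertices for each \<open>k \<in> H\<close>.\<close>
  then have "real (card Y * card H) \<le> (\<Sum>u\<in>Y. 2 * real (card {k \<in> H. u \<in> T k}))"
    using sum_bounded_below[of Y "real (card H)"] by simp
  also have "\<dots> \<le> (\<Sum>u\<in>UNIV. 2 * real (card {k \<in> H. u \<in> T k}))"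
    by (intro sum_mono2) auto
  also have "\<dots> = 2 * real (\<Sum>u\<in>UNIV. card {k \<in> H. u \<in> T k})"
    by (simp add: sum_distrib_left)
  also have "(\<Sum>u\<in>UNIV. card {k \<in> H. u \<in> T k}) = (\<Sum>k\<in>H. card (T k))"
    using sum_multicount_gen[of UNIV H "\<lambda>u k. u \<in> T k" "\<lambda>k. card (T k)"] fin by simp
  also have "2 * real (\<Sum>k\<in>H. card (T k)) \<le> 2 * (card H * t)"
    using sum_bounded_above[of H "\<lambda>k. real (card (T k))" t] by (simp add: H_def)
  finally have "card H * card Y \<le> card H * (2 * t)" by (simp add: mult_ac)
  moreover have "card H > 0" using id fin by (auto simp: card_gt_0_iff)
  ultimately have Y: "card Y \<le> 2 * t" by simp
  \<comment> \<open>Replacing \<open>L\<close> by \<open>X\<close> recolours only \<open>Y\<close>,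
    whose vertices have weight \<open>d\<close> each; the pairs are charged to either end.\<close>
  have "monochromatic_weight X \<le> (\<Sum>u\<in>UNIV. \<Sum>v\<in>UNIV. w u v * of_bool ((u \<in> L) = (v \<in> L)) +
      w u v * of_bool (u \<in> Y) + w u v * of_bool (v \<in> Y))"
    unfolding monochromatic_weight_def by (intro sum_mono) (auto simp: Y_def w_nonneg)
  also have "\<dots> = monochromatic_weight L + d * card Y + d * card Y"
    by (simp only: sum.distrib weighted_sum_left[of "\<lambda>u. of_bool (u \<in> Y)"]
        weighted_sum_right[of "\<lambda>u. of_bool (u \<in> Y)"] monochromatic_weight_def) simp
  also have "\<dots> \<le> h * t + d * (2 * t) + d * (2 * t)"
    using L Y d_pos by (intro add_mono mult_left_mono) auto
  finally have mono_X: "2 * monochromatic_weight X < CARD('v)" using t(2) by (simp add: algebra_simps)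
  define Q where "Q = {u. \<exists>v. w u v \<noteq> 0 \<and> ((u \<in> X) = (v \<in> X))}"
  \<comment> \<open>Nonzero weights are at least 1, so each vertex of \<open>Q\<close> contributes
    at least 1 to the monochromatic weight.\<close>
  have "real (card Q) = (\<Sum>u\<in>UNIV. of_bool (u \<in> Q))" by simp
  also have "\<dots> \<le> monochromatic_weight X"
    unfolding monochromatic_weight_def
  proof (rule sum_mono)
    fix u
    show "of_bool (u \<in> Q) \<le> (\<Sum>v\<in>UNIV. w u v * of_bool ((u \<in> X) = (v \<in> X)))"
    proof (cases "u \<in> Q")
      case True
      then obtain v where v: "w u v \<noteq> 0" "(u \<in> X) = (v \<in> X)" by (auto simp: Q_def)
      have "of_bool (u \<in> Q) \<le> w u v * of_bool ((u \<in> X) = (v \<in> X))"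
        using v integral True by simp
      also have "\<dots> \<le> (\<Sum>v\<in>UNIV. w u v * of_bool ((u \<in> X) = (v \<in> X)))"
        by (rule member_le_sum) (auto simp: w_nonneg)
      finally show ?thesis .
    qed (auto intro!: sum_nonneg simp: w_nonneg)
  qed
  finally have Q: "2 * card Q < CARD('v)" using mono_X by linarith
  have Q_inv: "g q \<in> Q" if g: "g \<in> H" and q: "q \<in> Q" for g q
  proof -
    obtain v where "w q v \<noteq> 0" "(q \<in> X) = (v \<in> X)" using q by (auto simp: Q_def)
    moreover have "w (g q) (g v) = w q v" using g by (simp add: H_def weight_automorphisms_def)
    ultimately show ?thesis unfolding Q_def by (auto simp: X_inv[OF g] intro!: exI[of _ "g v"])
  qed
  have "Q = {}"
  proof (rule ccontr)
    assume "Q \<noteq> {}"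
    then obtain q where q: "q \<in> Q" by auto
    \<comment> \<open>Take \<open>k = id\<close> if all automorphisms lie in \<open>H\<close>, and
      otherwise some \<open>k\<close> outside \<open>H\<close>. If \<open>g\<close> carries
      \<open>q\<close> to \<open>v\<close>, then \<open>g\<close> or \<open>k \<circ> g\<close> lies
      in \<open>H\<close>, so \<open>v\<close> or \<open>k v\<close> lies in
      \<open>Q\<close>.\<close>
    have "\<exists>k. bij k \<and> UNIV = Q \<union> {u. k u \<in> Q}"
    proof (cases "weight_automorphisms \<subseteq> H")
      case True
      have "v \<in> Q" for v
      proof -
        obtain g where "g \<in> weight_automorphisms" "g q = v" using trans by blast
        with True Q_inv[of g q] q show ?thesis by auto
      qed
      then show ?thesis by (intro exI[of _ id]) auto
    next
      case False
      then obtain k where k: "k \<in> weight_automorphisms" "k \<notin> H" by auto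
      have "v \<in> Q \<or> k v \<in> Q" for v
      proof -
        obtain g where g: "g \<in> weight_automorphisms" "g q = v" using trans by blast
        show ?thesis
          using Q_inv[of g q] Q_inv[OF comp'[OF k g(1)], of q] g q by auto
      qed
      then show ?thesis using k by (auto simp: weight_automorphisms_def)
    qed
    then obtain k where k: "bij k" "UNIV = Q \<union> {u. k u \<in> Q}" by blast
    have "CARD('v) \<le> card Q + card {u. k u \<in> Q}" unfolding k(2) by (rule card_Un_le)
    then show False using Q card_vimage_bij[OF k(1), of Q] by simp
  qed
  then show thesis by (intro that[of X]) (auto simp: Q_def)
qed

lemma eigenvalue_lower_bound:
  assumes eig: "\<And>u. (\<Sum>v\<in>UNIV. w u v * f v) = l * d * f u" and nz: "f x \<noteq> 0"
    and h: "0 < h" "h \<le> d" "1 \<le> d"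
    and integral: "\<And>u v. w u v \<noteq> 0 \<Longrightarrow> 1 \<le> w u v"
    and trans: "\<And>u v. \<exists>g\<in>weight_automorphisms. g u = v"
    and nonbip: "\<nexists>X. \<forall>u v. w u v \<noteq> 0 \<longrightarrow> (u \<in> X) \<noteq> (v \<in> X)"
  shows "- 1 + h ^ 4 / (2 ^ 9 * d ^ 10) < l"
proof (rule ccontr)
  assume "\<not> ?thesis"
  then have l: "1 + l \<le> h ^ 4 / (2 ^ 9 * d ^ 10)" by simp
  \<comment> \<open>Read off from the bound \<open>h * t\<close> on the monochromatic weight of the
    sign partition. The power of \<open>d\<close> gives \<open>16 * (d * t) \<le> CARD('v)\<close>,
    while the conditions on \<open>t\<close> need at most \<open>10 * (d * t)\<close>.\<close>
  define t where "t = h * CARD('v) / (16 * d ^ 7)"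
  have n: "0 < real CARD('v)" by simp
  have t0: "0 \<le> t" using h by (simp add: t_def)
  have "16 * (d * t) = h * CARD('v) / d ^ 6"
    using d_pos by (simp add: t_def field_simps eval_nat_numeral)
  also have "\<dots> \<le> d * CARD('v) / d"
    using h power_increasing[of 1 6 d] by (intro frac_le mult_right_mono) auto
  finally have dt: "16 * (d * t) \<le> CARD('v)" using d_pos by simp
  have "t \<le> d * t" "h * t \<le> d * t" using h t0 by (auto intro: mult_right_mono simp: mult_le_cancel_right1)
  moreover have "2 * (h + 4 * d) * t = 2 * (h * t) + 8 * (d * t)" by (simp add: algebra_simps)
  ultimately have "3 * t < CARD('v)" "2 * (h + 4 * d) * t < CARD('v)"
    using dt n t0 by linarith+
  then obtain X where "\<And>u v. w u v \<noteq> 0 \<Longrightarrow> (u \<in> X) \<noteq> (v \<in> X)"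
    using bipartition_of_almost_bipartition[OF integral trans
        monochromatic_weight_sign_le[OF eig nz h l, folded t_def] h(1)] by blast
  with nonbip show False by blast
qed

end

section \<open>From multigraphs to weighted graphs\<close>

text \<open>The operator preserves the sum of the entries, which forces sum zero when
  \<open>l\<close> differs from 1. If 1 is a multiple eigenvalue, an eigenvector that is not
  constant is projected off the constants.\<close>

lemma nontrivial_eigenvalue_orthogonal_eigenvector:
  fixes E :: "'v::finite multigraph"
  assumes "nontrivial_eigenvalue (normalised_adjacency E d) l" and reg: "regular E d" and d: "0 < d"
  obtains f where "f \<noteq> 0" "normalised_adjacency E d *v f = l *\<^sub>R f" "(\<Sum>v\<in>UNIV. f $ v) = 0"
proof -
  let ?M = "normalised_adjacency E d"
  have col: "(\<Sum>u\<in>UNIV. real (count E (Upair u v))) = d" for v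
    using reg unfolding regular_def degree_def
    by (metis (no_types, lifting) Upair_inject of_nat_sum sum.cong)
  have sum_mult: "(\<Sum>u\<in>UNIV. (?M *v f) $ u) = (\<Sum>u\<in>UNIV. f $ u)" for f
  proof -
    have "(\<Sum>u\<in>UNIV. (?M *v f) $ u) = (\<Sum>u\<in>UNIV. \<Sum>v\<in>UNIV. (f $ v / d) * real (count E (Upair u v)))"
      by (simp add: matrix_vector_mult_def normalised_adjacency_def adjacency_matrix_def mult.commute)
    also have "\<dots> = (\<Sum>v\<in>UNIV. \<Sum>u\<in>UNIV. (f $ v / d) * real (count E (Upair u v)))" by (rule sum.swap)
    also have "\<dots> = (\<Sum>u\<in>UNIV. f $ u)" using d by (simp only: col flip: sum_distrib_left) simp
    finally show ?thesis .
  qed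
  have orth: "l * (\<Sum>u\<in>UNIV. f $ u) = (\<Sum>u\<in>UNIV. f $ u)" if "?M *v f = l *\<^sub>R f" for f
    using sum_mult[of f] by (simp add: that sum_distrib_left)
  show thesis
  proof (cases "l = 1")
    case False
    then show ?thesis using assms(1) orth
      unfolding nontrivial_eigenvalue_def eigenvalue_def eigenspace_def
      by (auto intro: that)
  next
    case True
    have "1 < dim (eigenspace ?M l)" using assms(1) True by (simp add: nontrivial_eigenvalue_def)
    have ones: "?M *v 1 = 1"
      using reg d unfolding regular_def degree_def
      by (simp add: vec_eq_iff matrix_vector_mult_def normalised_adjacency_def adjacency_matrix_def
          flip: sum_divide_distrib of_nat_sum)
    have "\<not> eigenspace ?M l \<subseteq> span {1}"
      using dim_le_card[of "eigenspace ?M l" "{1}"] \<open>1 < dim (eigenspace ?M l)\<close> by auto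
    then obtain x where x: "?M *v x = x" "x \<notin> span {1}"
      using True by (auto simp: eigenspace_def)
    define c where "c = (\<Sum>v\<in>UNIV. x $ v) / CARD('v)"
    show ?thesis
    proof (rule that[of "x - c *\<^sub>R 1"])
      show "x - c *\<^sub>R 1 \<noteq> 0" using x(2) by (auto simp: span_singleton)
      show "?M *v (x - c *\<^sub>R 1) = l *\<^sub>R (x - c *\<^sub>R 1)"
        using x(1) ones True by (simp add: matrix_vector_mult_diff_distrib matrix_vector_mult_scaleR)
      show "(\<Sum>v\<in>UNIV. (x - c *\<^sub>R 1) $ v) = 0"
        by (simp add: sum_subtractf c_def)
    qed
  qed
qed

text \<open>A graph without edges is bipartite.\<close>

lemma regular_degree_pos:
  fixes E :: "'v::finite multigraph"
  assumes "\<not> bipartite E" "regular E d"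
  shows "0 < d"
proof (rule ccontr)
  assume "\<not> 0 < d"
  then have "count E (Upair u v) = 0" for u v
    using assms(2) by (simp add: regular_def degree_def)
  then have "\<not> adjacent E u v" for u v
    by (simp add: adjacent_def count_eq_zero_iff)
  then show False using assms(1) unfolding bipartite_def by blast
qed

text \<open>With two vertices, singletons are admissible and the minimum is attained. Were it 0, the
  minimising set would be closed under adjacency, hence everything by connectedness. A singleton
  gives the bound \<open>d\<close>.\<close>

lemma isoperimetric_constant_properties:
  fixes E :: "'v::finite multigraph"
  assumes conn: "graph_connected E" and reg: "regular E d" and card: "2 \<le> CARD('v)"
  defines "h \<equiv> isoperimetric_constant E"
  shows "0 < h" "h \<le> d"
    and "2 * card S \<le> CARD('v) \<Longrightarrow> h * card S \<le> (\<Sum>u\<in>S. \<Sum>v\<in>-S. real (count E (Upair u v)))"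
proof -
  let ?P = "\<lambda>A :: 'v set. A \<noteq> {} \<and> real (card A) \<le> real CARD('v) / 2"
  let ?r = "\<lambda>A. real (card (neighbourhood E A - A)) / real (card A)"
  have h: "h = Min (?r ` Collect ?P)"
    unfolding h_def isoperimetric_constant_def by (rule arg_cong[of _ _ Min]) auto
  have le: "h \<le> ?r A" if "?P A" for A
    unfolding h using that by (intro Min_le) auto
  have single: "?P {x}" for x using card by simp
  then have "?r ` Collect ?P \<noteq> {}" by blast
  then have "h \<in> ?r ` Collect ?P" unfolding h by (intro Min_in) auto
  then obtain A where A: "?P A" "h = ?r A" by auto
  have "neighbourhood E A - A \<noteq> {}"
  proof
    assume "neighbourhood E A - A = {}"
    then have closed: "v \<in> A" if "adjacent E u v" "u \<in> A" for u v
      using that by (auto simp: neighbourhood_def)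
    obtain a where a: "a \<in> A" using A by auto
    have "v \<in> A" for v
    proof -
      have "(adjacent E)\<^sup>*\<^sup>* a v" using conn by (simp add: graph_connected_def)
      then show ?thesis by induction (use a closed in auto)
    qed
    then have "A = UNIV" by auto
    then show False using A(1) card by simp
  qed
  then show "0 < h" using A by (simp add: card_gt_0_iff)
  have nb: "card (neighbourhood E S - S) \<le> (\<Sum>u\<in>S. \<Sum>v\<in>-S. real (count E (Upair u v)))" for S
  proof -
    have "real (card (neighbourhood E S - S)) = (\<Sum>v\<in>neighbourhood E S - S. 1)" by simp
    also have "\<dots> \<le> (\<Sum>v\<in>neighbourhood E S - S. \<Sum>u\<in>S. real (count E (Upair u v)))"
    proof (rule sum_mono)
      fix v assume "v \<in> neighbourhood E S - S"
      then obtain u where u: "u \<in> S" "Upair u v \<in># E" by (auto simp: neighbourhood_def adjacent_def)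
      then have "1 \<le> count E (Upair u v)" by (simp add: Suc_le_eq)
      then have "1 \<le> real (count E (Upair u v))" by linarith
      also have "\<dots> \<le> (\<Sum>u\<in>S. real (count E (Upair u v)))"
        using u by (intro member_le_sum) auto
      finally show "1 \<le> (\<Sum>u\<in>S. real (count E (Upair u v)))" .
    qed
    also have "\<dots> \<le> (\<Sum>v\<in>-S. \<Sum>u\<in>S. real (count E (Upair u v)))"
      by (intro sum_mono2) (auto intro: sum_nonneg)
    finally show ?thesis by (subst sum.swap)
  qed
  show "h * card S \<le> (\<Sum>u\<in>S. \<Sum>v\<in>-S. real (count E (Upair u v)))" if "2 * card S \<le> CARD('v)"
  proof (cases "S = {}")
    case False
    then have "h \<le> ?r S" using that by (intro le) auto
    then have "h * card S \<le> card (neighbourhood E S - S)"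
      using False by (simp add: field_simps card_gt_0_iff)
    then show ?thesis using nb[of S] by linarith
  qed simp
  fix x :: 'v
  have "h \<le> ?r {x}" by (rule le[OF single])
  also have "\<dots> \<le> (\<Sum>v\<in>-{x}. real (count E (Upair x v)))" using nb[of "{x}"] by simp
  also have "\<dots> \<le> (\<Sum>v\<in>UNIV. real (count E (Upair x v)))" by (intro sum_mono2) auto
  also have "\<dots> = d" using reg by (simp add: regular_def degree_def flip: of_nat_sum)
  finally show "h \<le> d" .
qed

theorem theorem1p1:
  fixes E :: "'v::finite multigraph" and d :: nat and h l :: real
  assumes "graph_connected E"
    and "\<not> bipartite E"
    and "vertex_transitive E"
    and "regular E d"
    and "h = isoperimetric_constant E"
    and "nontrivial_eigenvalue (normalised_adjacency E d) l"
  shows "- 1 + h ^ 4 / (2 ^ 9 * real d ^ 10) < l \<and> l \<le> 1 - h ^ 2 / (2 * real d ^ 2)"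
proof -
  have d: "0 < d" using assms(2,4) by (rule regular_degree_pos)
  obtain f where f: "f \<noteq> 0" "normalised_adjacency E d *v f = l *\<^sub>R f" "(\<Sum>v\<in>UNIV. f $ v) = 0"
    using assms(6,4) d by (rule nontrivial_eigenvalue_orthogonal_eigenvector)
  then obtain x where x: "f $ x \<noteq> 0" by (auto simp: vec_eq_iff)
  \<comment> \<open>On one vertex a vector with zero sum vanishes.\<close>
  have "CARD('v) \<noteq> 1"
  proof
    assume "CARD('v) = 1"
    then have "(UNIV :: 'v set) = {x}" by (metis UNIV_I card_1_singletonE singletonD)
    then have "(\<Sum>v\<in>UNIV. f $ v) = f $ x" by (metis finite.emptyI sum.insert sum.empty empty_iff add.right_neutral)
    with f(3) x show False by simp
  qed
  then have card: "2 \<le> CARD('v)" using zero_less_card_finite[where 'a = 'v] by linarith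
  note iso = isoperimetric_constant_properties[OF assms(1,4) card, folded assms(5)]
  define w where "w u v = real (count E (Upair u v))" for u v
  interpret weighted_graph w d h
  proof
    show "w u v = w v u" for u v by (metis Upair_inject w_def)
    show "(\<Sum>v\<in>UNIV. w u v) = d" for u
      using assms(4) by (simp add: w_def regular_def degree_def flip: of_nat_sum)
  qed (use d iso in \<open>auto simp: w_def\<close>)
  have eig: "(\<Sum>v\<in>UNIV. w u v * f $ v) = l * d * f $ u" for u
  proof -
    have "(normalised_adjacency E d *v f) $ u = (\<Sum>v\<in>UNIV. w u v * f $ v) / d"
      by (simp add: matrix_vector_mult_def normalised_adjacency_def adjacency_matrix_def w_def
          sum_divide_distrib)
    then show ?thesis using f(2) d by (simp add: field_simps)
  qed
  have aut: "g \<in> weight_automorphisms" if "g \<in> automorphisms E" for g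
  proof -
    have g: "bij g" "image_mset (map_uprod g) E = E" using that by (auto simp: automorphisms_def)
    then have inj: "inj (map_uprod g)" by (intro uprod.inj_map bij_is_inj)
    have "count E (Upair (g u) (g v)) = count E (Upair u v)" for u v
      using count_image_mset_inj[OF inj, of E "Upair u v"] g(2) by simp
    with g(1) show ?thesis by (simp add: weight_automorphisms_def w_def)
  qed
  have nonbip: "\<nexists>X. \<forall>u v. w u v \<noteq> 0 \<longrightarrow> (u \<in> X) \<noteq> (v \<in> X)"
  proof
    assume "\<exists>X. \<forall>u v. w u v \<noteq> 0 \<longrightarrow> (u \<in> X) \<noteq> (v \<in> X)"
    then obtain X where "\<And>u v. adjacent E u v \<Longrightarrow> (u \<in> X) \<noteq> (v \<in> X)"
      by (auto simp: w_def adjacent_def)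
    then have "bipartite E" unfolding bipartite_def
      by (intro exI[of _ X] exI[of _ "- X"]) auto
    with assms(2) show False by contradiction
  qed
  have "- 1 + h ^ 4 / (2 ^ 9 * real d ^ 10) < l"
  proof (rule eigenvalue_lower_bound[OF eig x iso(1,2) _ _ _ nonbip])
    show "1 \<le> w u v" if "w u v \<noteq> 0" for u v using that by (simp add: w_def Suc_le_eq)
    show "\<exists>g\<in>weight_automorphisms. g u = v" for u v
      using assms(3) aut unfolding vertex_transitive_def by blast
  qed (use d in simp)
  moreover have "l \<le> 1 - h ^ 2 / (2 * real d ^ 2)"
    by (rule eigenvalue_upper_bound[OF eig x f(3)])
  ultimately show ?thesis by blast
qed

end
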